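(* Let $G$ be a connected strongly regular graph with spectral parameters $\rho,\sigma,f,g$, and let $\mu$ be a positive integer. Then the pair $(G,\mu)$ is feasible if and only if all of the following hold: (a) $\rho$ and $\sigma$ are integers; (b) $-\frac{f+1}{f+g+1}\cdot\frac{f\rho+(g+1)\sigma}{\sigma^2}\le \mu\le -\frac{f+1}{2\sigma}$; (c) $f+1$ divides $g(\rho-\sigma)\mu$; (d) $f+g+1$ divides $fg(\rho-\sigma)\mu$; (e) the quantity $\Delta:=(f+g+1)\big(f+g+1-\frac{4f(\rho-\sigma)\mu}{f+1}\big)$ is a perfect square.
   Context: For a connected strongly regular graph $G$ (not complete), its adjacency matrix has exactly three distinct eigenvalues $a>\rho>\sigma$ with multiplicities $1,f,g$; $\rho,\sigma,f,g$ are its spectral parameters. Given $G$ and a positive integer $\mu$, define $v=f+1$, $b=f+g+1$, and for each root $\lambda$ of $$x^2-\big(f+g+1-2(\rho-\sigma)\mu\big)x+(\rho-\sigma)\mu\Big((\rho-\sigma)\mu-\frac{f+g+1}{f+1}\Big)=0$$ define $r=\lambda+(\rho-\sigma)\mu$, $\lambda_1=\frac{1}{f+g+1}\big((f+1)(\lambda+\rho\mu)+g\sigma\mu\big)$, $\lambda_2=\lambda_1+\mu$, $k=\lambda_1-\sigma\mu$. The pair $(G,\mu)$ is called feasible (for a quasi-symmetric 2-design with block graph $G$ and defect $\mu$) if, for both roots $\lambda$, all of $b,v,r,k,\lambda,\lambda_1,\lambda_2$ are non-negative integers satisfying $bk=rv$ and $r(k-1)=\lambda(v-1)$. (These are exactly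 the parameters that a quasi-symmetric 2-design with block graph $G$ and defect $\mu$, and its complement, would have.) *)

theory Defs
  imports
    "Graph_Theory.Digraph_Component"
    "Jordan_Normal_Form.Char_Poly"
    "HOL.Complex"
begin

text \<open>
  Finite simple graphs are the locale \<open>graph\<close>: symmetric, loop-free digraphs without parallel arcs,
  so \<open>out_degree\<close> is the valency and \<open>arcs_ends\<close> is the adjacency relation.
\<close>

definition common_neighbours :: "('a, 'b) pre_digraph \<Rightarrow> 'a \<Rightarrow> 'a \<Rightarrow> 'a set" where
  "common_neighbours G u v = {w \<in> verts G. u \<rightarrow>\<^bsub>G\<^esub> w \<and> v \<rightarrow>\<^bsub>G\<^esub> w}"

text \<open>Edgeless and complete graphs are excluded; complete multipartite graphs are not.\<close>

definition strongly_regular :: "('a, 'b) pre_digraph \<Rightarrow> bool" where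
  "strongly_regular G \<longleftrightarrow>
     (\<exists>u\<in>verts G. \<exists>v\<in>verts G. u \<rightarrow>\<^bsub>G\<^esub> v) \<and>
     (\<exists>u\<in>verts G. \<exists>v\<in>verts G. u \<noteq> v \<and> \<not> u \<rightarrow>\<^bsub>G\<^esub> v) \<and>
     (\<exists>a c d :: nat.
        (\<forall>u\<in>verts G. out_degree G u = a) \<and>
        (\<forall>u\<in>verts G. \<forall>v\<in>verts G. u \<rightarrow>\<^bsub>G\<^esub> v \<longrightarrow> card (common_neighbours G u v) = c) \<and>
        (\<forall>u\<in>verts G. \<forall>v\<in>verts G. u \<noteq> v \<and> \<not> u \<rightarrow>\<^bsub>G\<^esub> v \<longrightarrow>
            card (common_neighbours G u v) = d))"

text \<open>
  The adjacency matrix is taken with respect to an arbitrary but fixed enumeration of the vertices;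
  another choice conjugates it by a permutation matrix and leaves its spectrum unchanged.
\<close>

definition vertex_list :: "('a, 'b) pre_digraph \<Rightarrow> 'a list" where
  "vertex_list G = (SOME vs. distinct vs \<and> set vs = verts G)"

definition adjacency_matrix :: "('a, 'b) pre_digraph \<Rightarrow> real mat" where
  "adjacency_matrix G =
     mat (card (verts G)) (card (verts G))
       (\<lambda>(i, j). if (vertex_list G ! i) \<rightarrow>\<^bsub>G\<^esub> (vertex_list G ! j) then 1 else 0)"

definition eigenvalue_multiplicity :: "real mat \<Rightarrow> real \<Rightarrow> nat" where
  "eigenvalue_multiplicity A x = order x (char_poly A)"

definition spectral_parameters ::
    "('a, 'b) pre_digraph \<Rightarrow> real \<Rightarrow> real \<Rightarrow> nat \<Rightarrow> nat \<Rightarrow> bool" where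
  "spectral_parameters G \<rho> \<sigma> f g \<longleftrightarrow>
     (\<exists>a. a > \<rho> \<and> \<rho> > \<sigma> \<and>
        {x. eigenvalue (adjacency_matrix G) x} = {a, \<rho>, \<sigma>} \<and>
        eigenvalue_multiplicity (adjacency_matrix G) a = 1 \<and>
        eigenvalue_multiplicity (adjacency_matrix G) \<rho> = f \<and>
        eigenvalue_multiplicity (adjacency_matrix G) \<sigma> = g)"

text \<open>
  The roots \<open>l\<close> range over the complex numbers: with real roots only, the condition would hold
  vacuously whenever the quadratic has negative discriminant.
\<close>

definition feasible_parameters :: "real \<Rightarrow> real \<Rightarrow> nat \<Rightarrow> nat \<Rightarrow> nat \<Rightarrow> bool" where
  "feasible_parameters \<rho> \<sigma> f g \<mu> \<longleftrightarrow>
     (\<forall>l :: complex.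
        l\<^sup>2 - of_real (real (f + g + 1) - 2 * (\<rho> - \<sigma>) * real \<mu>) * l
          + of_real ((\<rho> - \<sigma>) * real \<mu> * ((\<rho> - \<sigma>) * real \<mu> - real (f + g + 1) / real (f + 1))) = 0
        \<longrightarrow>
        (let v = of_nat (f + 1);
             b = of_nat (f + g + 1);
             r = l + of_real ((\<rho> - \<sigma>) * real \<mu>);
             l1 = 1 / of_nat (f + g + 1) *
                    (of_nat (f + 1) * (l + of_real (\<rho> * real \<mu>)) + of_real (real g * \<sigma> * real \<mu>));
             l2 = l1 + of_nat \<mu>;
             k = l1 - of_real (\<sigma> * real \<mu>)
         in {b, v, r, k, l, l1, l2} \<subseteq> \<nat> \<and> b * k = r * v \<and> r * (k - 1) = l * (v - 1)))"

definition feasible :: "('a, 'b) pre_digraph \<Rightarrow> nat \<Rightarrow> bool" where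
  "feasible G \<mu> \<longleftrightarrow>
     (\<exists>\<rho> \<sigma> f g. spectral_parameters G \<rho> \<sigma> f g \<and> feasible_parameters \<rho> \<sigma> f g \<mu>)"

end

theory Submission
  imports Defs
begin

text \<open>
  Put \<open>v = f + 1\<close>, \<open>b = f + g + 1\<close> and \<open>n = (\<rho> - \<sigma>) \<mu>\<close>. In terms of \<open>r = \<lambda> + n\<close> the defining quadratic
  reads \<open>r\<^sup>2 - b r + b n f / v = 0\<close>, with discriminant \<open>\<Delta>\<close>, and \<open>k = v r / b\<close> is a root of
  \<open>k\<^sup>2 - v k + v n f / b = 0\<close>. Hence \<open>b k = r v\<close> and \<open>r (k - 1) = \<lambda> (v - 1)\<close> hold automatically.
  Integrality of both roots \<open>r\<close> amounts to (e) and (c), integrality of both \<open>k\<close> to (d), and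
  \<open>\<lambda>\<^sub>1 = k + \<sigma> \<mu> \<ge> 0\<close> for both roots says that \<open>- \<sigma> \<mu>\<close> lies to the left of both roots of the
  quadratic for \<open>k\<close>, which is (b). The graph contributes \<open>f > 0\<close>, \<open>\<sigma> < 0\<close>, read off the quadratic
  \<open>x\<^sup>2 - (c - d) x - (a - d)\<close> satisfied by every eigenvalue other than the valency, and the fact that
  rational eigenvalues of an integer matrix are integers.
\<close>

section \<open>Quadratics and integrality\<close>

lemma monic_quadratic_factor: "t\<^sup>2 - (x + y) * t + x * y = (t - x) * (t - y)"
  for t x y :: "'a :: comm_ring_1"
  by (simp add: algebra_simps power2_eq_square)

lemma monic_quadratic_Vieta:
  fixes x y :: "'a :: idom"
  assumes "x\<^sup>2 - B * x + C = 0" and "y\<^sup>2 - B * y + C = 0" and "x \<noteq> y"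
  shows "x + y = B" and "x * y = C"
proof -
  have "(x - y) * (x + y - B) = (x\<^sup>2 - B * x + C) - (y\<^sup>2 - B * y + C)"
    by (simp add: algebra_simps power2_eq_square)
  then show sum: "x + y = B" using assms by simp
  show "x * y = C" using assms(1) unfolding sum[symmetric] by (simp add: algebra_simps power2_eq_square)
qed

lemma Rats_root_monic_quadratic_in_Ints:
  fixes x :: "'a :: field_char_0"
  assumes "x \<in> \<rat>" and "B \<in> \<int>" and "C \<in> \<int>" and "x\<^sup>2 - B * x + C = 0"
  shows "x \<in> \<int>"
proof -
  have "algebraic_int x"
  proof (rule algebraic_int.intros)
    show "lead_coeff [:C, - B, 1:] = 1" by simp
    show "\<forall>i. coeff [:C, - B, 1:] i \<in> \<int>" using assms by (simp add: coeff_pCons split: nat.split)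
    show "poly [:C, - B, 1:] x = 0" using assms(4) by (simp add: algebra_simps power2_eq_square)
  qed
  then show ?thesis using \<open>x \<in> \<rat>\<close> by (rule rational_algebraic_int_is_int)
qed

lemma of_real_in_Nats_iff: "(of_real x :: 'a :: real_algebra_1) \<in> \<nat> \<longleftrightarrow> x \<in> \<nat>"
proof
  assume "(of_real x :: 'a) \<in> \<nat>"
  then obtain m where "(of_real x :: 'a) = of_real (real m)" by (auto elim: Nats_cases)
  then have "x = real m" by (simp only: of_real_eq_iff)
  then show "x \<in> \<nat>" by simp
qed (auto elim!: Nats_cases)

lemma Ints_add_left_iff:
  fixes x y :: "'a :: ring_1"
  assumes "x \<in> \<int>"
  shows "x + y \<in> \<int> \<longleftrightarrow> y \<in> \<int>"
  using assms by (metis Ints_add Ints_diff add_diff_cancel_left')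

lemma algebraic_int_mult_of_nat_in_Ints_iff:
  fixes x :: "'a :: field_char_0"
  assumes "algebraic_int x" and "m > 0"
  shows "x * of_nat m \<in> \<int> \<longleftrightarrow> x \<in> \<int>"
proof
  assume "x * of_nat m \<in> \<int>"
  then have "x * of_nat m / of_nat m \<in> \<rat>" using Ints_subset_Rats by (intro Rats_divide) auto
  then have "x \<in> \<rat>" using \<open>m > 0\<close> by simp
  then show "x \<in> \<int>" using assms(1) rational_algebraic_int_is_int by blast
qed simp

lemma both_ge_iff_sum_prod:
  fixes t x y :: "'a :: linordered_idom"
  shows "t \<le> x \<and> t \<le> y \<longleftrightarrow> 0 \<le> t\<^sup>2 - (x + y) * t + x * y \<and> 2 * t \<le> x + y"
  unfolding monic_quadratic_factor by (auto simp: zero_le_mult_iff)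

lemma Rats_both_in_Ints_iff_prod:
  fixes x y :: "'a :: field_char_0"
  assumes "x \<in> \<rat>" and "x + y \<in> \<int>"
  shows "x \<in> \<int> \<and> y \<in> \<int> \<longleftrightarrow> x * y \<in> \<int>"
proof
  assume prod: "x * y \<in> \<int>"
  have "x\<^sup>2 - (x + y) * x + x * y = 0" by (simp add: monic_quadratic_factor)
  then have "x \<in> \<int>" by (rule Rats_root_monic_quadratic_in_Ints[OF assms prod])
  then show "x \<in> \<int> \<and> y \<in> \<int>" using assms(2) by (simp add: Ints_add_left_iff)
qed simp

lemma ex_Rats_sum_prod_iff_discriminant_square:
  fixes B C :: "'a :: field_char_0"
  assumes "B \<in> \<int>" and "C \<in> \<int>"
  shows "(\<exists>x y. x + y = B \<and> x * y = C \<and> x \<in> \<rat>) \<longleftrightarrow> (\<exists>m :: int. B\<^sup>2 - 4 * C = (of_int m)\<^sup>2)"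
proof
  assume "\<exists>x y. x + y = B \<and> x * y = C \<and> x \<in> \<rat>"
  then obtain x y where sum_prod: "x + y = B" "x * y = C" and "x \<in> \<rat>" by blast
  then have "x - y \<in> \<int>" using Rats_both_in_Ints_iff_prod[of x y] assms by auto
  then obtain m where "x - y = of_int m" by (elim Ints_cases)
  then have "B\<^sup>2 - 4 * C = (of_int m)\<^sup>2"
    using sum_prod by (auto simp: algebra_simps power2_eq_square)
  then show "\<exists>m :: int. B\<^sup>2 - 4 * C = (of_int m)\<^sup>2" ..
next
  assume "\<exists>m :: int. B\<^sup>2 - 4 * C = (of_int m)\<^sup>2"
  then obtain m :: int where m: "B\<^sup>2 - 4 * C = (of_int m)\<^sup>2" ..
  let ?x = "(B + of_int m) / 2" and ?y = "(B - of_int m) / 2"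
  have "?x * ?y = (B\<^sup>2 - (of_int m)\<^sup>2) / 4" by (simp add: field_simps power2_eq_square)
  then have "?x * ?y = C" by (simp add: m[symmetric])
  moreover have "?x + ?y = B" by (simp add: field_simps)
  moreover have "?x \<in> \<rat>" using assms(1) Ints_subset_Rats by (intro Rats_divide Rats_add) auto
  ultimately show "\<exists>x y. x + y = B \<and> x * y = C \<and> x \<in> \<rat>" by blast
qed

lemma all_roots_monic_quadratic_iff:
  fixes B C :: "'a :: alg_closed_field"
  shows "(\<forall>z. z\<^sup>2 - B * z + C = 0 \<longrightarrow> P z) \<longleftrightarrow> (\<exists>z w. z + w = B \<and> z * w = C \<and> P z \<and> P w)"
proof
  assume all_roots: "\<forall>z. z\<^sup>2 - B * z + C = 0 \<longrightarrow> P z"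
  obtain z where "poly [:C, - B, 1:] z = 0"
    using alg_closed_imp_poly_has_root[of "[:C, - B, 1:]"] by auto
  then have root: "z\<^sup>2 - B * z + C = 0" by (simp add: algebra_simps power2_eq_square)
  then have prod: "z * (B - z) = C" by (simp add: algebra_simps power2_eq_square)
  have "(B - z)\<^sup>2 - B * (B - z) + C = 0"
    using monic_quadratic_factor[of "B - z" z "B - z"] by (simp add: prod)
  then show "\<exists>z w. z + w = B \<and> z * w = C \<and> P z \<and> P w"
    using root prod all_roots by (intro exI[of _ z] exI[of _ "B - z"]) simp
next
  assume "\<exists>z w. z + w = B \<and> z * w = C \<and> P z \<and> P w"
  then obtain z w where "z + w = B" "z * w = C" "P z" "P w" by blast
  then show "\<forall>z. z\<^sup>2 - B * z + C = 0 \<longrightarrow> P z"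
    using monic_quadratic_factor[of _ z w] by auto
qed

section \<open>Adjacency eigenvalues of graphs\<close>

lemma eigenvalue_of_int_mat_algebraic_int:
  fixes x :: "'a :: field_char_0"
  assumes A: "A \<in> carrier_mat n n" and "eigenvalue (map_mat of_int A) x"
  shows "algebraic_int x"
proof -
  have "char_poly (map_mat of_int A) = map_poly (of_int :: int \<Rightarrow> 'a) (char_poly A)"
    by (rule of_int_hom.char_poly_hom[OF A])
  then have "poly (map_poly of_int (char_poly A)) x = 0"
    using assms eigenvalue_root_char_poly[of "map_mat of_int A" n x] by simp
  moreover have "lead_coeff (char_poly A) = 1"
    using degree_monic_char_poly[OF A] by auto
  ultimately show ?thesis by (auto simp: algebraic_int_altdef_ipoly)
qed

lemma eigenvalue_multiplicity_pos_iff: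
  assumes A: "A \<in> carrier_mat n n"
  shows "eigenvalue_multiplicity A x > 0 \<longleftrightarrow> eigenvalue A x"
proof -
  have "char_poly A \<noteq> 0" using degree_monic_char_poly[OF A] by auto
  then show ?thesis
    by (simp add: eigenvalue_multiplicity_def eigenvalue_root_char_poly[OF A] order_root)
qed

definition neighbours :: "('a, 'b) pre_digraph \<Rightarrow> 'a \<Rightarrow> 'a set" where
  "neighbours G u = {w \<in> verts G. u \<rightarrow>\<^bsub>G\<^esub> w}"

definition adjacency_eigenfunction :: "('a, 'b) pre_digraph \<Rightarrow> real \<Rightarrow> ('a \<Rightarrow> real) \<Rightarrow> bool" where
  "adjacency_eigenfunction G x h \<longleftrightarrow>
     (\<exists>u\<in>verts G. h u \<noteq> 0) \<and> (\<forall>u\<in>verts G. (\<Sum>w\<in>neighbours G u. h w) = x * h u)"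

lemma adjacency_matrix_carrier:
  "adjacency_matrix G \<in> carrier_mat (card (verts G)) (card (verts G))"
  by (simp add: adjacency_matrix_def)

lemma adjacency_matrix_eigenvalue_algebraic_int:
  assumes "eigenvalue (adjacency_matrix G) x"
  shows "algebraic_int x"
proof -
  let ?n = "card (verts G)"
  define A :: "int mat" where
    "A = mat ?n ?n (\<lambda>(i, j). if (vertex_list G ! i) \<rightarrow>\<^bsub>G\<^esub> (vertex_list G ! j) then 1 else 0)"
  have "adjacency_matrix G = map_mat of_int A"
    by (rule eq_matI) (auto simp: A_def adjacency_matrix_def)
  moreover have "A \<in> carrier_mat ?n ?n" by (simp add: A_def)
  ultimately show ?thesis using assms eigenvalue_of_int_mat_algebraic_int by metis
qed

lemma
  assumes "finite (verts G)"
  shows distinct_vertex_list: "distinct (vertex_list G)"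
    and set_vertex_list: "set (vertex_list G) = verts G"
proof -
  have "\<exists>vs. distinct vs \<and> set vs = verts G" using finite_distinct_list[OF assms] by blast
  then have "distinct (vertex_list G) \<and> set (vertex_list G) = verts G"
    unfolding vertex_list_def by (rule someI_ex)
  then show "distinct (vertex_list G)" and "set (vertex_list G) = verts G" by blast+
qed

lemma bij_betw_vertex_list:
  assumes "finite (verts G)"
  shows "bij_betw ((!) (vertex_list G)) {0..<card (verts G)} (verts G)"
  using bij_betw_nth[OF distinct_vertex_list[OF assms]] distinct_card[OF distinct_vertex_list[OF assms]]
  by (simp add: set_vertex_list[OF assms] atLeast0LessThan)

lemma adjacency_matrix_mult_vec_index:
  assumes fin: "finite (verts G)" and i: "i < card (verts G)"
  shows "(adjacency_matrix G *\<^sub>v vec (card (verts G)) (\<lambda>j. h (vertex_list G ! j))) $ i =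
    (\<Sum>w\<in>neighbours G (vertex_list G ! i). h w)"
proof -
  let ?u = "vertex_list G ! i"
  have "(adjacency_matrix G *\<^sub>v vec (card (verts G)) (\<lambda>j. h (vertex_list G ! j))) $ i =
      (\<Sum>j\<in>{0..<card (verts G)}. of_bool (?u \<rightarrow>\<^bsub>G\<^esub> vertex_list G ! j) * h (vertex_list G ! j))"
    using i by (simp add: adjacency_matrix_def scalar_prod_def of_bool_def cong: if_cong)
  also have "\<dots> = (\<Sum>w\<in>verts G. of_bool (?u \<rightarrow>\<^bsub>G\<^esub> w) * h w)"
    by (rule sum.reindex_bij_betw[OF bij_betw_vertex_list[OF fin]])
  also have "\<dots> = (\<Sum>w\<in>neighbours G ?u. h w)"
    using fin by (intro sum.mono_neutral_cong_right) (auto simp: neighbours_def)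
  finally show ?thesis .
qed

lemma eigenvalue_adjacency_matrix_imp_eigenfunction:
  assumes fin: "finite (verts G)" and "eigenvalue (adjacency_matrix G) x"
  obtains h where "adjacency_eigenfunction G x h"
proof -
  let ?n = "card (verts G)" and ?A = "adjacency_matrix G"
  obtain w where w: "w \<in> carrier_vec ?n" "w \<noteq> 0\<^sub>v ?n" "?A *\<^sub>v w = x \<cdot>\<^sub>v w"
    using assms(2) carrier_matD[OF adjacency_matrix_carrier[of G]]
    by (auto simp: eigenvalue_def eigenvector_def)
  define h where "h u = w $ the_inv_into {0..<?n} ((!) (vertex_list G)) u" for u
  note vertex_bij = bij_betw_vertex_list[OF fin]
  have h_nth: "h (vertex_list G ! i) = w $ i" if "i < ?n" for i
    using that by (simp add: h_def the_inv_into_f_f[OF bij_betw_imp_inj_on[OF vertex_bij]])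
  then have w_eq: "vec ?n (\<lambda>i. h (vertex_list G ! i)) = w" using w(1) by auto
  have vertex_index: "\<exists>i<?n. u = vertex_list G ! i" if "u \<in> verts G" for u
    using that bij_betw_imp_surj_on[OF vertex_bij] by force
  obtain i where "i < ?n" "w $ i \<noteq> 0" using w(1,2) by (metis carrier_vecD eq_vecI index_zero_vec)
  then have "h (vertex_list G ! i) \<noteq> 0" "vertex_list G ! i \<in> verts G"
    using h_nth bij_betwE[OF vertex_bij] by auto
  moreover have "(\<Sum>w\<in>neighbours G u. h w) = x * h u" if u: "u \<in> verts G" for u
  proof -
    obtain i where i: "i < ?n" "u = vertex_list G ! i" using vertex_index[OF u] by blast
    then show ?thesis
      using adjacency_matrix_mult_vec_index[OF fin i(1), of h] w(1,3) h_nth by (simp add: w_eq)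
  qed
  ultimately show thesis using that unfolding adjacency_eigenfunction_def by blast
qed

lemma common_neighbours_eq_Int: "common_neighbours G u v = neighbours G u \<inter> neighbours G v"
  by (auto simp: common_neighbours_def neighbours_def)

lemma neighbours_subset_verts: "neighbours G u \<subseteq> verts G"
  by (auto simp: neighbours_def)

lemma (in fin_digraph) finite_neighbours: "finite (neighbours G u)"
  by (simp add: neighbours_def)

lemma (in loopfree_digraph) not_in_neighbours_self: "u \<notin> neighbours G u"
  by (auto simp: neighbours_def dest: adj_not_same)

lemma (in nomulti_digraph) card_neighbours: "card (neighbours G u) = out_degree G u"
proof -
  have "inj_on (head G) (out_arcs G u)"
    by (rule inj_onI) (auto intro!: no_multi_arcs simp: arc_to_ends_def)
  moreover have "head G ` out_arcs G u = neighbours G u"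
    by (auto simp: neighbours_def arcs_ends_conv image_iff intro: in_arcs_imp_in_arcs_ends)
  ultimately show ?thesis unfolding out_degree_def by (metis card_image)
qed

lemma (in graph) sum_over_neighbours_swap:
  assumes "S \<subseteq> verts G"
  shows "(\<Sum>u\<in>S. \<Sum>w\<in>neighbours G u. h w) =
    (\<Sum>w\<in>verts G. of_nat (card (S \<inter> neighbours G w)) * h w :: 'c :: comm_semiring_1)"
proof -
  have "finite S" using assms finite_verts finite_subset by blast
  then have "(\<Sum>u\<in>S. \<Sum>w\<in>neighbours G u. h w) = (\<Sum>w\<in>verts G. \<Sum>u | u \<in> S \<and> u \<rightarrow>\<^bsub>G\<^esub> w. h w)"
    unfolding neighbours_def by (intro sum.swap_restrict) auto
  moreover have "{u. u \<in> S \<and> u \<rightarrow>\<^bsub>G\<^esub> w} = S \<inter> neighbours G w" for w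
    using assms by (auto simp: neighbours_def intro: graph_symmetric)
  ultimately show ?thesis by simp
qed

lemma (in digraph) sum_verts_split_neighbours:
  fixes F :: "'a \<Rightarrow> 'c :: comm_monoid_add"
  assumes "u \<in> verts G"
  shows "sum F (verts G) =
    F u + sum F (neighbours G u) + sum F (verts G - insert u (neighbours G u))"
proof -
  have "sum F (verts G) = sum F (insert u (neighbours G u)) + sum F (verts G - insert u (neighbours G u))"
    using assms by (subst add.commute, intro sum.subset_diff) (auto simp: neighbours_def)
  then show ?thesis using not_in_neighbours_self finite_neighbours by simp
qed

section \<open>Strongly regular graphs\<close>

locale srg = graph G for G :: "('a, 'b) pre_digraph" (structure) +
  fixes a c d :: nat
  assumes out_degree: "u \<in> verts G \<Longrightarrow> out_degree G u = a"
    and card_common_neighbours_adj: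
      "\<lbrakk>u \<in> verts G; w \<in> verts G; u \<rightarrow>\<^bsub>G\<^esub> w\<rbrakk> \<Longrightarrow> card (common_neighbours G u w) = c"
    and card_common_neighbours_nonadj:
      "\<lbrakk>u \<in> verts G; w \<in> verts G; u \<noteq> w; \<not> u \<rightarrow>\<^bsub>G\<^esub> w\<rbrakk> \<Longrightarrow> card (common_neighbours G u w) = d"
    and adjacent_pair: "\<exists>u\<in>verts G. \<exists>w\<in>verts G. u \<rightarrow>\<^bsub>G\<^esub> w"
    and nonadjacent_pair: "\<exists>u\<in>verts G. \<exists>w\<in>verts G. u \<noteq> w \<and> \<not> u \<rightarrow>\<^bsub>G\<^esub> w"

lemma strongly_regular_imp_srg:
  assumes "graph G" and "strongly_regular G"
  obtains a c d where "srg G a c d"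
proof -
  from assms(2) obtain a c d :: nat
    where "\<forall>u\<in>verts G. out_degree G u = a"
      and "\<forall>u\<in>verts G. \<forall>w\<in>verts G. u \<rightarrow>\<^bsub>G\<^esub> w \<longrightarrow> card (common_neighbours G u w) = c"
      and "\<forall>u\<in>verts G. \<forall>w\<in>verts G. u \<noteq> w \<and> \<not> u \<rightarrow>\<^bsub>G\<^esub> w \<longrightarrow> card (common_neighbours G u w) = d"
    unfolding strongly_regular_def by auto
  moreover have "\<exists>u\<in>verts G. \<exists>w\<in>verts G. u \<rightarrow>\<^bsub>G\<^esub> w"
    and "\<exists>u\<in>verts G. \<exists>w\<in>verts G. u \<noteq> w \<and> \<not> u \<rightarrow>\<^bsub>G\<^esub> w"
    using assms(2) by (simp_all add: strongly_regular_def)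
  ultimately have "srg G a c d"
    by (intro srg.intro srg_axioms.intro assms(1)) auto
  then show thesis using that by simp
qed

context srg
begin

lemma card_neighbours_eq: "u \<in> verts G \<Longrightarrow> card (neighbours G u) = a"
  by (simp add: card_neighbours out_degree)

lemma d_le_a: "d \<le> a"
proof -
  obtain u w where "u \<in> verts G" "w \<in> verts G" "u \<noteq> w" "\<not> u \<rightarrow>\<^bsub>G\<^esub> w"
    using nonadjacent_pair by blast
  then show ?thesis
    using card_mono[OF finite_neighbours Int_lower1, of u "neighbours G w"]
      card_common_neighbours_nonadj[of u w]
    by (simp add: common_neighbours_eq_Int card_neighbours_eq)
qed

lemma c_less_a: "c < a"
proof -
  obtain u w where uw: "u \<in> verts G" "w \<in> verts G" "u \<rightarrow>\<^bsub>G\<^esub> w" using adjacent_pair by blast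
  have "w \<in> neighbours G u" "w \<notin> common_neighbours G u w"
    using uw not_in_neighbours_self by (auto simp: neighbours_def common_neighbours_eq_Int)
  then have "common_neighbours G u w \<subset> neighbours G u" by (auto simp: common_neighbours_eq_Int)
  then have "card (common_neighbours G u w) < card (neighbours G u)"
    by (rule psubset_card_mono[OF finite_neighbours])
  then show ?thesis using uw by (simp add: card_common_neighbours_adj card_neighbours_eq)
qed

text \<open>The entries of \<open>A\<^sup>2 = a I + c A + d (J - I - A)\<close>, where \<open>J\<close> is the all-one matrix.\<close>

lemma sum_neighbours_of_neighbours:
  fixes h :: "'a \<Rightarrow> real"
  assumes "u \<in> verts G"
  shows "(\<Sum>w\<in>neighbours G u. sum h (neighbours G w)) =
    a * h u + c * sum h (neighbours G u) + d * sum h (verts G - insert u (neighbours G u))"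
proof -
  let ?paths = "\<lambda>w. real (card (common_neighbours G u w)) * h w"
  have "(\<Sum>w\<in>neighbours G u. sum h (neighbours G w)) = sum ?paths (verts G)"
    using sum_over_neighbours_swap[OF neighbours_subset_verts] by (simp add: common_neighbours_eq_Int)
  also have "\<dots> = ?paths u + sum ?paths (neighbours G u)
      + sum ?paths (verts G - insert u (neighbours G u))"
    by (rule sum_verts_split_neighbours[OF assms])
  also have "?paths u = a * h u" using assms by (simp add: common_neighbours_eq_Int card_neighbours_eq)
  also have "sum ?paths (neighbours G u) = c * sum h (neighbours G u)"
    using assms card_common_neighbours_adj by (auto simp: sum_distrib_left neighbours_def intro: sum.cong)
  also have "sum ?paths (verts G - insert u (neighbours G u))
      = d * sum h (verts G - insert u (neighbours G u))"
    using assms card_common_neighbours_nonadj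
    by (auto simp: sum_distrib_left neighbours_def intro: sum.cong)
  finally show ?thesis .
qed

lemma sum_eigenfunction_eq_0:
  assumes h: "adjacency_eigenfunction G x h" and "x \<noteq> a"
  shows "sum h (verts G) = 0"
proof -
  have "x * sum h (verts G) = (\<Sum>u\<in>verts G. \<Sum>w\<in>neighbours G u. h w)"
    using h by (simp add: adjacency_eigenfunction_def sum_distrib_left)
  also have "\<dots> = (\<Sum>w\<in>verts G. real (card (verts G \<inter> neighbours G w)) * h w)"
    by (rule sum_over_neighbours_swap) simp
  also have "\<dots> = a * sum h (verts G)"
    by (simp add: Int_absorb1 neighbours_subset_verts card_neighbours_eq sum_distrib_left)
  finally show ?thesis using \<open>x \<noteq> a\<close> by simp
qed

lemma eigenvalue_quadratic:
  assumes "eigenvalue (adjacency_matrix G) x" and "x \<noteq> a"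
  shows "x\<^sup>2 - (real c - real d) * x + (real d - real a) = 0"
proof -
  obtain h where h: "adjacency_eigenfunction G x h"
    using eigenvalue_adjacency_matrix_imp_eigenfunction[OF finite_verts assms(1)] .
  then obtain u where u: "u \<in> verts G" "h u \<noteq> 0" by (auto simp: adjacency_eigenfunction_def)
  have sum_h: "sum h (neighbours G w) = x * h w" if "w \<in> verts G" for w
    using h that by (simp add: adjacency_eigenfunction_def)
  have "x\<^sup>2 * h u = (\<Sum>w\<in>neighbours G u. x * h w)"
    using sum_h[OF u(1)] by (simp add: sum_distrib_left[symmetric] power2_eq_square)
  also have "\<dots> = (\<Sum>w\<in>neighbours G u. sum h (neighbours G w))"
    using sum_h by (intro sum.cong) (auto simp: neighbours_def)
  also have "\<dots> = a * h u + c * (x * h u) + d * sum h (verts G - insert u (neighbours G u))"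
    using sum_neighbours_of_neighbours[OF u(1)] sum_h[OF u(1)] by simp
  also have "sum h (verts G - insert u (neighbours G u)) = - h u - x * h u"
    using sum_verts_split_neighbours[OF u(1), of h] sum_eigenfunction_eq_0[OF h \<open>x \<noteq> a\<close>] sum_h[OF u(1)]
    by simp
  finally have "(x\<^sup>2 - (real c - real d) * x + (real d - real a)) * h u = 0"
    by (simp add: algebra_simps)
  then show ?thesis using u(2) by simp
qed

lemma smaller_eigenvalue_neg:
  assumes "eigenvalue (adjacency_matrix G) x" and "eigenvalue (adjacency_matrix G) y"
    and "x \<noteq> a" and "y \<noteq> a" and "x < y"
  shows "x < 0"
proof (rule ccontr)
  assume "\<not> x < 0"
  have sum: "x + y = real c - real d" and prod: "x * y = real d - real a"
    using monic_quadratic_Vieta[OF eigenvalue_quadratic eigenvalue_quadratic] assms by auto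
  have "0 \<le> x * y" using \<open>\<not> x < 0\<close> \<open>x < y\<close> by simp
  then have "d = a" using prod d_le_a by simp
  then show False using sum c_less_a \<open>\<not> x < 0\<close> \<open>x < y\<close> by simp
qed

end

lemma strongly_regular_spectral_parameters:
  assumes "graph G" and "strongly_regular G" and "spectral_parameters G \<rho> \<sigma> f g"
  shows "\<sigma> < 0" and "f > 0"
    and "algebraic_int \<rho>" and "algebraic_int \<sigma>"
proof -
  obtain a c d where "srg G a c d" using strongly_regular_imp_srg[OF assms(1,2)] .
  then interpret srg G a c d .
  obtain t where t: "t > \<rho>" "\<rho> > \<sigma>" "{x. eigenvalue (adjacency_matrix G) x} = {t, \<rho>, \<sigma>}"
    "eigenvalue_multiplicity (adjacency_matrix G) \<rho> = f"
    using assms(3) unfolding spectral_parameters_def by blast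
  then have eigenvalues: "eigenvalue (adjacency_matrix G) t" "eigenvalue (adjacency_matrix G) \<rho>"
    "eigenvalue (adjacency_matrix G) \<sigma>" by blast+
  show "\<sigma> < 0"
    using smaller_eigenvalue_neg[OF eigenvalues(3,2)] smaller_eigenvalue_neg[OF eigenvalues(3,1)]
      smaller_eigenvalue_neg[OF eigenvalues(2,1)] t(1,2) by force
  show "f > 0" using eigenvalue_multiplicity_pos_iff[OF adjacency_matrix_carrier] eigenvalues(2) t(4) by metis
  show "algebraic_int \<rho>" "algebraic_int \<sigma>"
    using eigenvalues by (blast intro: adjacency_matrix_eigenvalue_algebraic_int)+
qed

lemma spectral_parameters_unique:
  assumes "spectral_parameters G \<rho> \<sigma> f g" and "spectral_parameters G \<rho>' \<sigma>' f' g'"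
  shows "\<rho>' = \<rho>" and "\<sigma>' = \<sigma>" and "f' = f" and "g' = g"
proof -
  let ?spectrum = "{x. eigenvalue (adjacency_matrix G) x}"
  have order_statistics: "Min ?spectrum = z" "?spectrum - {Min ?spectrum, Max ?spectrum} = {y}"
    if "spectral_parameters G y z m n" for y z m n
  proof -
    obtain t where t: "t > y" "y > z" "?spectrum = {t, y, z}"
      using \<open>spectral_parameters G y z m n\<close> unfolding spectral_parameters_def by blast
    then have "Min ?spectrum = z" "Max ?spectrum = t" by simp_all
    then show "Min ?spectrum = z" "?spectrum - {Min ?spectrum, Max ?spectrum} = {y}" using t by auto
  qed
  show "\<sigma>' = \<sigma>" "\<rho>' = \<rho>"
    using order_statistics[OF assms(1)] order_statistics[OF assms(2)] by auto
  then show "f' = f" "g' = g" using assms by (auto simp: spectral_parameters_def)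
qed

section \<open>Parameters of quasi-symmetric designs\<close>

locale quasi_symmetric_parameters =
  fixes \<rho> \<sigma> :: real and f g \<mu> :: nat
begin

text \<open>
  In a design with these parameters \<open>n = r - \<lambda>\<close> is the order, and \<open>intersection_gap\<close> is \<open>k - \<lambda>\<^sub>1\<close>.
  The two roots of the quadratic belong to a design and its complement: their replication numbers
  have sum \<open>b\<close>, their block sizes have sum \<open>v\<close>, and the products are as below.
\<close>

definition v :: real where "v = real (f + 1)"

definition b :: real where "b = real (f + g + 1)"

definition n :: real where "n = (\<rho> - \<sigma>) * real \<mu>"

definition replication_product :: real where "replication_product = b * n * real f / v"

definition block_size_product :: real where "block_size_product = v * n * real f / b"

definition intersection_gap :: real where "intersection_gap = - \<sigma> * real \<mu>"

definition admissible :: "real \<Rightarrow> bool" where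
  "admissible r \<longleftrightarrow> {r, r - n, v * r / b, v * r / b - intersection_gap} \<subseteq> \<nat>"

lemma v_pos: "v > 0" and b_pos: "b > 0" and v_eq: "v = real f + 1" and b_eq: "b = v + real g"
  by (simp_all add: v_def b_def)

lemma v_Nats: "v \<in> \<nat>" and b_Nats: "b \<in> \<nat>"
  by (simp_all only: v_def b_def of_nat_in_Nats)

lemma replication_quadratic_shift:
  fixes l :: "'a :: real_field"
  shows "l\<^sup>2 - of_real (b - 2 * n) * l + of_real (n * (n - b / v)) =
    (l + of_real n)\<^sup>2 - of_real b * (l + of_real n) + of_real replication_product"
proof -
  have "replication_product = b * n - b * n / v"
    using v_pos by (simp add: replication_product_def v_eq field_simps)
  then have "of_real replication_product = (of_real (b * n) - of_real (b * n / v) :: 'a)"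
    by (simp only: of_real_diff)
  then show ?thesis by (simp add: algebra_simps power2_eq_square)
qed

lemma intersection_number_shift:
  fixes l :: "'a :: real_field"
  shows "1 / of_real b * (of_real v * (l + of_real (\<rho> * real \<mu>)) + of_real (real g * \<sigma> * real \<mu>)) =
    of_real (v / b) * (l + of_real n) - of_real intersection_gap"
proof -
  have "v * (\<rho> * real \<mu>) + real g * \<sigma> * real \<mu> = v * n - b * intersection_gap"
    by (simp add: n_def intersection_gap_def b_eq algebra_simps)
  then have "of_real v * of_real (\<rho> * real \<mu>) + of_real (real g * \<sigma> * real \<mu>) =
      (of_real v * of_real n - of_real b * of_real intersection_gap :: 'a)"
    by (simp only: flip: of_real_add of_real_diff of_real_mult)
  then show ?thesis using b_pos by (simp add: field_simps)
qed

lemma replication_root_design_equation: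
  fixes z :: "'a :: real_field"
  assumes "z\<^sup>2 - of_real b * z + of_real replication_product = 0"
  shows "z * (of_real (v / b) * z - 1) = (z - of_real n) * (of_real v - 1)"
proof -
  have "v / b * replication_product = n * (v - 1)"
    using v_pos b_pos by (simp add: replication_product_def v_eq)
  then have replication: "of_real (v / b) * of_real replication_product = (of_real n * (of_real v - 1) :: 'a)"
    by (metis of_real_1 of_real_diff of_real_mult)
  have blocks: "of_real (v / b) * of_real b = (of_real v :: 'a)" using b_pos by simp
  have "z * (of_real (v / b) * z - 1) =
      of_real (v / b) * (z\<^sup>2 - of_real b * z + of_real replication_product)
      + of_real (v / b) * of_real b * z - of_real (v / b) * of_real replication_product - z"
    by (simp add: algebra_simps power2_eq_square del: of_real_divide)
  also have "\<dots> = (z - of_real n) * (of_real v - 1)"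
    unfolding assms replication blocks by (simp add: algebra_simps)
  finally show ?thesis .
qed

lemma feasible_at_root_iff_admissible:
  fixes l :: complex
  defines "r \<equiv> l + of_real n"
  defines "k \<equiv> of_real (v / b) * r"
  defines "l1 \<equiv> k - of_real intersection_gap"
  assumes root: "r\<^sup>2 - of_real b * r + of_real replication_product = 0"
  shows "{of_real b, of_real v, r, k, l, l1, l1 + of_nat \<mu>} \<subseteq> \<nat> \<and>
      of_real b * k = r * of_real v \<and> r * (k - 1) = l * (of_real v - 1) \<longleftrightarrow>
    (\<exists>x. r = of_real x \<and> admissible x)"
proof -
  have l_eq: "l = r - of_real n" by (simp add: r_def)
  have "of_real b * k = r * of_real v" using b_pos by (simp add: k_def)
  moreover have "r * (k - 1) = l * (of_real v - 1)"
    unfolding l_eq k_def by (rule replication_root_design_equation[OF root])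
  moreover have "{of_real b, of_real v, r, k, l, l1, l1 + of_nat \<mu>} \<subseteq> \<nat> \<longleftrightarrow> {r, l, k, l1} \<subseteq> \<nat>"
    using v_Nats b_Nats by (auto simp: of_real_in_Nats_iff)
  moreover have "{r, l, k, l1} \<subseteq> \<nat> \<longleftrightarrow> (\<exists>x. r = of_real x \<and> admissible x)"
  proof -
    have "{r, l, k, l1} \<subseteq> \<nat> \<longleftrightarrow> admissible x" if "r = of_real x" for x
    proof -
      have "{r, l, k, l1} = of_real ` {x, x - n, v * x / b, v * x / b - intersection_gap}"
        by (simp add: l_eq that k_def l1_def)
      then show ?thesis
        unfolding admissible_def by (simp only: image_subset_iff of_real_in_Nats_iff) blast
    qed
    moreover have "\<exists>x. r = of_real x" if "{r, l, k, l1} \<subseteq> \<nat>"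
      using that by (metis Nats_cases insert_subset of_real_of_nat_eq)
    ultimately show ?thesis by metis
  qed
  ultimately show ?thesis by (simp only: simp_thms)
qed

lemma feasible_parameters_iff_roots_admissible:
  "feasible_parameters \<rho> \<sigma> f g \<mu> \<longleftrightarrow>
    (\<forall>z :: complex. z\<^sup>2 - of_real b * z + of_real replication_product = 0 \<longrightarrow>
      (\<exists>r. z = of_real r \<and> admissible r))"
    (is "_ \<longleftrightarrow> (\<forall>z. ?root z \<longrightarrow> ?adm z)")
proof -
  define L :: "complex \<Rightarrow> complex" where
    "L l = 1 / of_real b * (of_real v * (l + of_real (\<rho> * real \<mu>)) + of_real (real g * \<sigma> * real \<mu>))" for l
  have "feasible_parameters \<rho> \<sigma> f g \<mu> \<longleftrightarrow>
      (\<forall>l. l\<^sup>2 - of_real (b - 2 * n) * l + of_real (n * (n - b / v)) = 0 \<longrightarrow>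
        {of_real b, of_real v, l + of_real n, L l + of_real intersection_gap, l, L l, L l + of_nat \<mu>} \<subseteq> \<nat> \<and>
        of_real b * (L l + of_real intersection_gap) = (l + of_real n) * of_real v \<and>
        (l + of_real n) * (L l + of_real intersection_gap - 1) = l * (of_real v - 1))"
    unfolding feasible_parameters_def L_def n_def b_def v_def intersection_gap_def Let_def
    by (simp only: of_real_of_nat_eq mult.assoc mult_minus_left of_real_minus add_uminus_conv_diff)
  also have "\<dots> \<longleftrightarrow> (\<forall>l. ?root (l + of_real n) \<longrightarrow> ?adm (l + of_real n))"
    unfolding L_def intersection_number_shift replication_quadratic_shift diff_add_cancel
    by (intro all_cong1 imp_cong refl feasible_at_root_iff_admissible)
  also have "\<dots> \<longleftrightarrow> (\<forall>z. ?root z \<longrightarrow> ?adm z)" by (metis diff_add_cancel)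
  finally show ?thesis .
qed

lemma feasible_parameters_iff_ex_admissible:
  "feasible_parameters \<rho> \<sigma> f g \<mu> \<longleftrightarrow>
    (\<exists>r r'. r + r' = b \<and> r * r' = replication_product \<and> admissible r \<and> admissible r')"
proof -
  have "feasible_parameters \<rho> \<sigma> f g \<mu> \<longleftrightarrow>
      (\<exists>r r'. complex_of_real r + of_real r' = of_real b \<and>
        complex_of_real r * of_real r' = of_real replication_product \<and> admissible r \<and> admissible r')"
    unfolding feasible_parameters_iff_roots_admissible all_roots_monic_quadratic_iff by blast
  then show ?thesis by (simp only: of_real_eq_iff flip: of_real_add of_real_mult)
qed

lemma admissible_iff:
  assumes "f > 0" and "intersection_gap > 0"
    and root: "r\<^sup>2 - b * r + replication_product = 0"
  shows "admissible r \<longleftrightarrow>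
    r \<in> \<int> \<and> v * r / b \<in> \<int> \<and> n \<in> \<int> \<and> intersection_gap \<in> \<int> \<and> intersection_gap \<le> v * r / b"
proof
  assume "admissible r"
  then have nats: "r \<in> \<nat>" "r - n \<in> \<nat>" "v * r / b \<in> \<nat>" "v * r / b - intersection_gap \<in> \<nat>"
    by (simp_all add: admissible_def)
  then have ints: "r \<in> \<int>" "r - n \<in> \<int>" "v * r / b \<in> \<int>" "v * r / b - intersection_gap \<in> \<int>"
    using Nats_subset_Ints by blast+
  have "n \<in> \<int>" using Ints_diff[OF ints(1,2)] by simp
  moreover have "intersection_gap \<in> \<int>" using Ints_diff[OF ints(3,4)] by simp
  moreover have "0 \<le> v * r / b - intersection_gap" using nats(4) by (auto elim: Nats_cases)
  ultimately show "r \<in> \<int> \<and> v * r / b \<in> \<int> \<and> n \<in> \<int> \<and> intersection_gap \<in> \<int> \<and> intersection_gap \<le> v * r / b"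
    using ints by simp
next
  assume integral: "r \<in> \<int> \<and> v * r / b \<in> \<int> \<and> n \<in> \<int> \<and> intersection_gap \<in> \<int> \<and> intersection_gap \<le> v * r / b"
  then have k_pos: "0 < v * r / b" using \<open>intersection_gap > 0\<close> by linarith
  then have r_pos: "0 < r" using v_pos b_pos by (simp add: zero_less_divide_iff zero_less_mult_iff)
  obtain k where k: "v * r / b = of_int k" using integral by (auto elim: Ints_cases)
  then have "v * r / b \<ge> 1" using k_pos by simp
  then have "0 \<le> r * (v * r / b - 1)" using r_pos by simp
  also have "\<dots> = (r - n) * real f"
    using replication_root_design_equation[of r] root by (simp add: v_eq)
  finally have "0 \<le> r - n" using \<open>f > 0\<close> by (simp add: zero_le_mult_iff)
  then show "admissible r"
    using integral k_pos r_pos unfolding admissible_def Nats_altdef2 by auto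
qed

lemma block_sizes_sum_prod:
  assumes "r + r' = b" and "r * r' = replication_product"
  shows "v * r / b + v * r' / b = v" and "(v * r / b) * (v * r' / b) = block_size_product"
proof -
  have "v * r / b + v * r' / b = v * (r + r') / b" by (simp add: add_divide_distrib distrib_left)
  then show "v * r / b + v * r' / b = v" using b_pos by (simp add: assms(1))
  have "(v * r / b) * (v * r' / b) = v\<^sup>2 * (r * r') / b\<^sup>2" by (simp add: power2_eq_square)
  also have "\<dots> = block_size_product"
    unfolding assms(2) replication_product_def block_size_product_def
    using v_pos b_pos by (simp add: power2_eq_square)
  finally show "(v * r / b) * (v * r' / b) = block_size_product" .
qed

lemma both_admissible_iff:
  assumes "f > 0" and "intersection_gap > 0"
    and sum: "r + r' = b" and prod: "r * r' = replication_product"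
  shows "admissible r \<and> admissible r' \<longleftrightarrow>
    r \<in> \<rat> \<and> replication_product \<in> \<int> \<and> block_size_product \<in> \<int> \<and> n \<in> \<int> \<and> intersection_gap \<in> \<int> \<and>
    0 \<le> intersection_gap\<^sup>2 - v * intersection_gap + block_size_product \<and> 2 * intersection_gap \<le> v"
proof -
  let ?k = "v * r / b" and ?k' = "v * r' / b" and ?t = intersection_gap
  have "r\<^sup>2 - b * r + replication_product = 0" "r'\<^sup>2 - b * r' + replication_product = 0"
    using monic_quadratic_factor[of r r r'] monic_quadratic_factor[of r' r r'] by (simp_all add: sum prod)
  then have "admissible r \<and> admissible r' \<longleftrightarrow> (r \<in> \<int> \<and> r' \<in> \<int>) \<and> (?k \<in> \<int> \<and> ?k' \<in> \<int>) \<and>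
      n \<in> \<int> \<and> intersection_gap \<in> \<int> \<and> (?t \<le> ?k \<and> ?t \<le> ?k')"
    using admissible_iff[OF assms(1,2)] by blast
  also have "?t \<le> ?k \<and> ?t \<le> ?k' \<longleftrightarrow> 0 \<le> ?t\<^sup>2 - v * ?t + block_size_product \<and> 2 * ?t \<le> v"
    unfolding both_ge_iff_sum_prod[of ?t ?k ?k'] block_sizes_sum_prod[OF sum prod] ..
  also have "(r \<in> \<int> \<and> r' \<in> \<int>) \<and> (?k \<in> \<int> \<and> ?k' \<in> \<int>) \<and> T \<longleftrightarrow>
      r \<in> \<rat> \<and> replication_product \<in> \<int> \<and> block_size_product \<in> \<int> \<and> T" for T
  proof (cases "r \<in> \<rat>")
    case True
    have "v \<in> \<int>" "b \<in> \<int>" using v_Nats b_Nats Nats_subset_Ints by blast+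
    then have "?k \<in> \<rat>" using True Ints_subset_Rats by (intro Rats_divide Rats_mult) auto
    then have "?k \<in> \<int> \<and> ?k' \<in> \<int> \<longleftrightarrow> block_size_product \<in> \<int>"
      using Rats_both_in_Ints_iff_prod[of ?k ?k'] block_sizes_sum_prod[OF sum prod] \<open>v \<in> \<int>\<close> by simp
    moreover have "r \<in> \<int> \<and> r' \<in> \<int> \<longleftrightarrow> replication_product \<in> \<int>"
      using Rats_both_in_Ints_iff_prod[OF True, of r'] sum prod \<open>b \<in> \<int>\<close> by simp
    ultimately show ?thesis using True by blast
  qed (use Ints_subset_Rats in blast)
  finally show ?thesis by blast
qed

lemma feasible_parameters_iff_integrality:
  assumes "f > 0" and "intersection_gap > 0"
  shows "feasible_parameters \<rho> \<sigma> f g \<mu> \<longleftrightarrow>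
    (n \<in> \<int> \<and> intersection_gap \<in> \<int>) \<and>
    (0 \<le> intersection_gap\<^sup>2 - v * intersection_gap + block_size_product \<and> 2 * intersection_gap \<le> v) \<and>
    replication_product \<in> \<int> \<and> block_size_product \<in> \<int> \<and>
    (\<exists>m :: int. b\<^sup>2 - 4 * replication_product = (of_int m)\<^sup>2)"
    (is "_ \<longleftrightarrow> ?integrality")
proof -
  have "b \<in> \<int>" using b_Nats Nats_subset_Ints by blast
  have "feasible_parameters \<rho> \<sigma> f g \<mu> \<longleftrightarrow>
      (n \<in> \<int> \<and> intersection_gap \<in> \<int>) \<and>
      (0 \<le> intersection_gap\<^sup>2 - v * intersection_gap + block_size_product \<and> 2 * intersection_gap \<le> v) \<and>
      replication_product \<in> \<int> \<and> block_size_product \<in> \<int> \<and>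
      (\<exists>r r'. r + r' = b \<and> r * r' = replication_product \<and> r \<in> \<rat>)"
    unfolding feasible_parameters_iff_ex_admissible using both_admissible_iff[OF assms] by blast
  also have "\<dots> \<longleftrightarrow> ?integrality"
    using ex_Rats_sum_prod_iff_discriminant_square[OF \<open>b \<in> \<int>\<close>] by blast
  finally show ?thesis .
qed

lemma defect_lower_bound_iff:
  assumes "\<mu> > 0" and "\<sigma> < 0"
  shows "- (v / b) * ((real f * \<rho> + real (g + 1) * \<sigma>) / \<sigma>\<^sup>2) \<le> real \<mu> \<longleftrightarrow>
    0 \<le> intersection_gap\<^sup>2 - v * intersection_gap + block_size_product"
proof -
  let ?q = "\<sigma>\<^sup>2 * real \<mu> + v / b * (real f * \<rho> + real (g + 1) * \<sigma>)"
  have "real \<mu> * ?q = intersection_gap\<^sup>2 - v * intersection_gap + block_size_product"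
    using b_pos by (simp add: block_size_product_def intersection_gap_def n_def b_eq v_eq field_simps power2_eq_square)
  then have "0 \<le> intersection_gap\<^sup>2 - v * intersection_gap + block_size_product \<longleftrightarrow> 0 \<le> real \<mu> * ?q"
    by simp
  also have "\<dots> \<longleftrightarrow> 0 \<le> ?q" using \<open>\<mu> > 0\<close> by (simp add: zero_le_mult_iff)
  also have "\<dots> \<longleftrightarrow> - (v / b * (real f * \<rho> + real (g + 1) * \<sigma>)) / \<sigma>\<^sup>2 \<le> real \<mu>"
    using \<open>\<sigma> < 0\<close> by (subst pos_divide_le_eq) (auto simp: algebra_simps)
  finally show ?thesis by simp
qed

lemma replication_product_in_Ints_iff:
  assumes "n \<in> \<int>"
  shows "replication_product \<in> \<int> \<longleftrightarrow> real g * n / v \<in> \<int>"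
proof -
  have "replication_product = n * (real f + real g) + - (real g * n / v)"
    using v_pos by (simp add: replication_product_def b_eq v_eq field_simps)
  moreover have "n * (real f + real g) \<in> \<int>" using assms by simp
  ultimately show ?thesis by (simp only: Ints_add_left_iff minus_in_Ints_iff)
qed

lemma block_size_product_in_Ints_iff:
  assumes "n \<in> \<int>"
  shows "block_size_product \<in> \<int> \<longleftrightarrow> real f * real g * n / b \<in> \<int>"
proof -
  have "block_size_product = n * real f + - (real f * real g * n / b)"
    using b_pos by (simp add: block_size_product_def b_eq field_simps)
  moreover have "n * real f \<in> \<int>" using assms by simp
  ultimately show ?thesis by (simp only: Ints_add_left_iff minus_in_Ints_iff)
qed

lemma order_and_gap_in_Ints_iff:
  assumes "\<mu> > 0" and "algebraic_int \<rho>" and "algebraic_int \<sigma>"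
  shows "n \<in> \<int> \<and> intersection_gap \<in> \<int> \<longleftrightarrow> (\<exists>p s. \<rho> = of_int p \<and> \<sigma> = of_int s)"
proof -
  have "n - intersection_gap = \<rho> * real \<mu>" "- intersection_gap = \<sigma> * real \<mu>"
    by (simp_all add: n_def intersection_gap_def algebra_simps)
  then have "n \<in> \<int> \<and> intersection_gap \<in> \<int> \<longleftrightarrow> \<rho> * real \<mu> \<in> \<int> \<and> \<sigma> * real \<mu> \<in> \<int>"
    by (metis Ints_diff Ints_add diff_add_cancel minus_in_Ints_iff)
  also have "\<dots> \<longleftrightarrow> \<rho> \<in> \<int> \<and> \<sigma> \<in> \<int>" by (simp add: algebraic_int_mult_of_nat_in_Ints_iff assms)
  also have "\<dots> \<longleftrightarrow> (\<exists>p s. \<rho> = of_int p \<and> \<sigma> = of_int s)" by (auto elim!: Ints_cases)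
  finally show ?thesis .
qed

lemma feasible_parameters_iff:
  assumes "f > 0" and "\<mu> > 0" and "\<sigma> < 0" and "algebraic_int \<rho>" and "algebraic_int \<sigma>"
  shows "feasible_parameters \<rho> \<sigma> f g \<mu> \<longleftrightarrow>
    (\<exists>p s :: int.
       (\<rho> = of_int p \<and> \<sigma> = of_int s) \<and>
       (- (v / b) * ((real f * \<rho> + real (g + 1) * \<sigma>) / \<sigma>\<^sup>2) \<le> real \<mu> \<and>
        real \<mu> \<le> - (v / (2 * \<sigma>))) \<and>
       int (f + 1) dvd int g * (p - s) * int \<mu> \<and>
       int (f + g + 1) dvd int f * int g * (p - s) * int \<mu> \<and>
       (\<exists>m :: int. b * (b - 4 * real f * (\<rho> - \<sigma>) * real \<mu> / v) = (of_int m)\<^sup>2))"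
    (is "_ \<longleftrightarrow> (\<exists>p s. (\<rho> = of_int p \<and> \<sigma> = of_int s) \<and> (_ \<and> ?upper) \<and>
                    ?dvd_v p s \<and> ?dvd_b p s \<and> ?square)")
proof -
  have gap_pos: "intersection_gap > 0" using assms by (simp add: intersection_gap_def mult_neg_pos)
  have upper: "?upper \<longleftrightarrow> 2 * intersection_gap \<le> v"
    using \<open>\<sigma> < 0\<close> by (auto simp: intersection_gap_def field_simps)
  have "b * (b - 4 * real f * (\<rho> - \<sigma>) * real \<mu> / v) = b\<^sup>2 - 4 * replication_product"
    by (simp add: replication_product_def n_def algebra_simps power2_eq_square)
  then have square: "?square \<longleftrightarrow> (\<exists>m :: int. b\<^sup>2 - 4 * replication_product = (of_int m)\<^sup>2)" by simp
  have dvd_iffs: "?dvd_v p s \<longleftrightarrow> replication_product \<in> \<int>" "?dvd_b p s \<longleftrightarrow> block_size_product \<in> \<int>"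
    if "\<rho> = of_int p" "\<sigma> = of_int s" for p s
  proof -
    have n_eq: "n = of_int ((p - s) * int \<mu>)" unfolding n_def by (simp add: that)
    then have "n \<in> \<int>" by simp
    have "real g * n / v = of_int (int g * (p - s) * int \<mu>) / of_int (int (f + 1))"
      "real f * real g * n / b = of_int (int f * int g * (p - s) * int \<mu>) / of_int (int (f + g + 1))"
      by (simp_all add: n_eq v_def b_def)
    then show "?dvd_v p s \<longleftrightarrow> replication_product \<in> \<int>" "?dvd_b p s \<longleftrightarrow> block_size_product \<in> \<int>"
      unfolding replication_product_in_Ints_iff[OF \<open>n \<in> \<int>\<close>] block_size_product_in_Ints_iff[OF \<open>n \<in> \<int>\<close>]
      by (simp_all only: of_int_div_of_int_in_Ints_iff) simp_all
  qed
  show ?thesis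
    unfolding feasible_parameters_iff_integrality[OF assms(1) gap_pos] upper square
      defect_lower_bound_iff[OF assms(2,3)] order_and_gap_in_Ints_iff[OF assms(2,4,5)]
    using dvd_iffs by metis
qed

end

theorem theorem2p3:
  fixes G :: "('a, 'b) pre_digraph" and \<rho> \<sigma> :: real and f g \<mu> :: nat
  assumes "graph G" and "connected G" and "strongly_regular G"
    and "spectral_parameters G \<rho> \<sigma> f g"
    and "\<mu> > 0"
  shows "feasible G \<mu> \<longleftrightarrow>
    (\<exists>p s :: int.
       (\<rho> = of_int p \<and> \<sigma> = of_int s) \<and>
       (- (real (f + 1) / real (f + g + 1)) * ((real f * \<rho> + real (g + 1) * \<sigma>) / \<sigma>\<^sup>2) \<le> real \<mu> \<and>
        real \<mu> \<le> - (real (f + 1) / (2 * \<sigma>))) \<and>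
       int (f + 1) dvd int g * (p - s) * int \<mu> \<and>
       int (f + g + 1) dvd int f * int g * (p - s) * int \<mu> \<and>
       (\<exists>m :: int. real (f + g + 1) *
            (real (f + g + 1) - 4 * real f * (\<rho> - \<sigma>) * real \<mu> / real (f + 1)) = (of_int m)\<^sup>2))"
proof -
  interpret quasi_symmetric_parameters \<rho> \<sigma> f g \<mu> .
  note spectral = strongly_regular_spectral_parameters[OF assms(1,3,4)]
  have "feasible G \<mu> \<longleftrightarrow> feasible_parameters \<rho> \<sigma> f g \<mu>"
    using assms(4) spectral_parameters_unique[OF assms(4)] unfolding feasible_def by metis
  then show ?thesis
    unfolding feasible_parameters_iff[OF spectral(2) assms(5) spectral(1,3,4)] v_def b_def .
qed

end
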